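(* Let $\mathbb{F}_q$ be a finite field with $q$ elements, let $n \geq 1$ be an integer, and let $f(x) \in \mathbb{F}_q[x]$ be a monic irreducible polynomial of degree $n$. Then the number of $n \times n$ matrices with entries in $\mathbb{F}_q$ whose characteristic polynomial is $f$ equals $$\prod_{i=1}^{n-1}\left(q^n - q^i\right).$$
   Context: The characteristic polynomial of an $n\times n$ matrix $M$ is the monic polynomial $\det(xI_n - M)$. An empty product (the case $n=1$) equals $1$. *)

theory Defs
  imports "Jordan_Normal_Form.Char_Poly" "HOL-Library.Cardinality"
begin

end

theory Submission
  imports Defs "Berlekamp_Zassenhaus.Berlekamp_Type_Based"
begin

hide_const (open) module.smult

text \<open>
  The count is a double counting of pairs \<open>(A, v)\<close>, where \<open>A\<close> has characteristic
  polynomial \<open>f\<close> and \<open>v\<close> is a nonzero vector.  The polynomials that annihilate \<open>v\<close>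
  under \<open>A\<close> are the multiples of one of them, and by the Cayley-Hamilton theorem
  (\<open>poly_act_char_poly\<close>) \<open>f\<close> is among them.  Since \<open>f\<close> is irreducible and nonzero constants
  do not annihilate \<open>v\<close>, every nonzero annihilator has degree at least \<open>n\<close>; hence \<open>v\<close> is
  cyclic: \<open>v, A v, \<dots>, A ^ (n - 1) v\<close> is a basis (\<open>irreducible_char_poly_cyclic\<close>).

  Conversely a basis \<open>b\<^sub>0, \<dots>, b\<^sub>n\<^sub>-\<^sub>1\<close> arises from exactly one such pair.  Necessarily
  \<open>v = b\<^sub>0\<close>, \<open>A\<close> sends each \<open>b\<^sub>i\<close> with \<open>i < n - 1\<close> to \<open>b\<^sub>i\<^sub>+\<^sub>1\<close>, and the relation
  \<open>f(A) v = 0\<close> determines the image of \<open>b\<^sub>n\<^sub>-\<^sub>1\<close>.  The matrix with these images has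
  characteristic polynomial \<open>f\<close>: the difference of the two monic polynomials annihilates the
  cyclic vector \<open>v\<close> and has degree below \<open>n\<close>, so it vanishes
  (\<open>char_poly_eq_cyclic_annihilator\<close>).  This avoids evaluating the determinant of a companion
  matrix and computing a centralizer.

  Writing \<open>N\<close> for the number of matrices sought, the bijection
  (\<open>bij_betw_cyclic_pairs_bases\<close>) gives \<open>N * (q ^ n - 1) = (\<Prod>i<n. q ^ n - q ^ i)\<close>,
  the number of ordered bases (\<open>card_indep_lists\<close>), and cancelling the factor for \<open>i = 0\<close>
  yields the claim.
\<close>

lemma mult_mat_vec_index_sum:
  assumes "A \<in> carrier_mat m n" "v \<in> carrier_vec n" "r < m"
  shows "(A *\<^sub>v v) $ r = (\<Sum>s<n. A $$ (r, s) * v $ s)"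
  using assms by (auto simp: scalar_prod_def atLeast0LessThan intro!: sum.cong)

section \<open>Counting linearly independent lists of vectors\<close>

text \<open>
  Independence is phrased as triviality of a kernel.  For \<open>n\<close> vectors this is the
  criterion for a nonzero determinant, and a kernel vector of a matrix of iterates is
  the coefficient sequence of an annihilating polynomial.
\<close>
definition indep_list :: "nat \<Rightarrow> 'a::field vec list \<Rightarrow> bool" where
  "indep_list n bs \<longleftrightarrow> set bs \<subseteq> carrier_vec n \<and>
    (\<forall>c \<in> carrier_vec (length bs). mat_of_cols n bs *\<^sub>v c = 0\<^sub>v n \<longrightarrow> c = 0\<^sub>v (length bs))"

definition combinations :: "nat \<Rightarrow> 'a::field vec list \<Rightarrow> 'a vec set" where
  "combinations n bs = (\<lambda>c. mat_of_cols n bs *\<^sub>v c) ` carrier_vec (length bs)"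

lemma mat_of_cols_Cons_mult_vCons:
  fixes v :: "'a::field vec"
  assumes "v \<in> carrier_vec n" "set bs \<subseteq> carrier_vec n" "c \<in> carrier_vec (length bs)"
  shows "mat_of_cols n (v # bs) *\<^sub>v vCons a c = a \<cdot>\<^sub>v v + mat_of_cols n bs *\<^sub>v c"
proof (rule eq_vecI)
  fix r assume "r < dim_vec (a \<cdot>\<^sub>v v + mat_of_cols n bs *\<^sub>v c)"
  then have r: "r < n" by simp
  have "(mat_of_cols n (v # bs) *\<^sub>v vCons a c) $ r =
      (\<Sum>s<Suc (length bs). mat_of_cols n (v # bs) $$ (r, s) * vCons a c $ s)"
    by (rule mult_mat_vec_index_sum) (use r assms in auto)
  also have "\<dots> = v $ r * a + (\<Sum>s<length bs. mat_of_cols n bs $$ (r, s) * c $ s)"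
    unfolding sum.lessThan_Suc_shift
    by (auto simp: mat_of_cols_Cons_index_0 mat_of_cols_Cons_index_Suc r)
  also have "(\<Sum>s<length bs. mat_of_cols n bs $$ (r, s) * c $ s) = (mat_of_cols n bs *\<^sub>v c) $ r"
    by (rule mult_mat_vec_index_sum[symmetric]) (use r assms in auto)
  finally show "(mat_of_cols n (v # bs) *\<^sub>v vCons a c) $ r = (a \<cdot>\<^sub>v v + mat_of_cols n bs *\<^sub>v c) $ r"
    using r assms by simp
qed (use assms in auto)

text \<open>
  This is the step of the count: an independent list is extended by any vector outside the span.
  A relation with nonzero coefficient at the new vector \<open>v\<close> can be solved for \<open>v\<close>.
\<close>
lemma indep_list_Cons:
  "indep_list n (v # bs) \<longleftrightarrow>
    indep_list n bs \<and> v \<in> carrier_vec n \<and> v \<notin> combinations n bs" (is "?L \<longleftrightarrow> ?R")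
proof
  assume L: ?L
  then have v: "v \<in> carrier_vec n" and bs: "set bs \<subseteq> carrier_vec n"
    by (auto simp: indep_list_def)
  have ker: "vCons a c = 0\<^sub>v (Suc (length bs))"
    if "c \<in> carrier_vec (length bs)" "a \<cdot>\<^sub>v v + mat_of_cols n bs *\<^sub>v c = 0\<^sub>v n" for a c
    using L that mat_of_cols_Cons_mult_vCons[OF v bs that(1), of a]
    unfolding indep_list_def by simp
  have "c = 0\<^sub>v (length bs)"
    if c: "c \<in> carrier_vec (length bs)" and "mat_of_cols n bs *\<^sub>v c = 0\<^sub>v n" for c
  proof -
    have "0 \<cdot>\<^sub>v v + mat_of_cols n bs *\<^sub>v c = 0\<^sub>v n" using v that by auto
    from ker[OF c this] show ?thesis by (simp add: zero_vec_Suc)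
  qed
  moreover have "v \<notin> combinations n bs"
  proof
    assume "v \<in> combinations n bs"
    then obtain c where c: "c \<in> carrier_vec (length bs)" and vc: "v = mat_of_cols n bs *\<^sub>v c"
      by (auto simp: combinations_def)
    (* The relation v = w is a kernel element whose first coefficient is -1. *)
    have "(-1) \<cdot>\<^sub>v v + mat_of_cols n bs *\<^sub>v c = 0\<^sub>v n"
      unfolding vc[symmetric] using v by auto
    from ker[OF c this] show False by (simp add: zero_vec_Suc)
  qed
  ultimately show ?R using v bs by (auto simp: indep_list_def)
next
  assume R: ?R
  then have v: "v \<in> carrier_vec n" and bs: "set bs \<subseteq> carrier_vec n"
    and nv: "v \<notin> combinations n bs"
    and ind: "\<And>c. c \<in> carrier_vec (length bs) \<Longrightarrow> mat_of_cols n bs *\<^sub>v c = 0\<^sub>v n \<Longrightarrow> c = 0\<^sub>v (length bs)"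
    by (auto simp: indep_list_def)
  have "d = 0\<^sub>v (Suc (length bs))"
    if d: "d \<in> carrier_vec (Suc (length bs))" and z: "mat_of_cols n (v # bs) *\<^sub>v d = 0\<^sub>v n" for d
  proof -
    obtain a c where dc: "d = vCons a c" using d by (cases d) auto
    then have c: "c \<in> carrier_vec (length bs)" using d by simp
    let ?w = "mat_of_cols n bs *\<^sub>v c"
    have w: "?w \<in> carrier_vec n" by (rule mult_mat_vec_carrier[OF mat_of_cols_carrier(1) c])
    have s: "a \<cdot>\<^sub>v v + ?w = 0\<^sub>v n"
      using z mat_of_cols_Cons_mult_vCons[OF v bs c] dc by simp
    have a: "a = 0"
    proof (rule ccontr)
      assume a: "a \<noteq> 0"
      have "v = (- inverse a) \<cdot>\<^sub>v ?w"
      proof (rule eq_vecI)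
        fix r assume "r < dim_vec ((- inverse a) \<cdot>\<^sub>v ?w)"
        then have r: "r < n" by simp
        have "a * v $ r + ?w $ r = 0" using arg_cong[OF s, of "\<lambda>x. x $ r"] r v by simp
        then have "?w $ r = - (a * v $ r)" by (simp add: eq_neg_iff_add_eq_0 add.commute)
        then show "v $ r = ((- inverse a) \<cdot>\<^sub>v ?w) $ r" using r a by simp
      qed (use v in auto)
      also have "\<dots> = mat_of_cols n bs *\<^sub>v ((- inverse a) \<cdot>\<^sub>v c)"
        by (rule mult_mat_vec[symmetric, OF mat_of_cols_carrier(1) c])
      finally have "v = mat_of_cols n bs *\<^sub>v ((- inverse a) \<cdot>\<^sub>v c)" .
      moreover have "mat_of_cols n bs *\<^sub>v ((- inverse a) \<cdot>\<^sub>v c) \<in> combinations n bs"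
        unfolding combinations_def by (rule imageI) (use c in simp)
      ultimately show False using nv by metis
    qed
    have "0 \<cdot>\<^sub>v v + ?w = ?w" using v w by (intro eq_vecI) auto
    then have "?w = 0\<^sub>v n" using s a by simp
    from ind[OF c this] show ?thesis unfolding dc a zero_vec_Suc by simp
  qed
  then show ?L using v bs unfolding indep_list_def by simp
qed

lemma card_combinations:
  fixes bs :: "'a::{finite,field} vec list"
  assumes "indep_list n bs"
  shows "card (combinations n bs) = CARD('a) ^ length bs"
proof -
  have "inj_on (\<lambda>c. mat_of_cols n bs *\<^sub>v c) (carrier_vec (length bs))"
  proof (rule inj_onI)
    fix c d assume c: "c \<in> carrier_vec (length bs)" and d: "d \<in> carrier_vec (length bs)"
      and eq: "mat_of_cols n bs *\<^sub>v c = mat_of_cols n bs *\<^sub>v d"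
    have "mat_of_cols n bs *\<^sub>v (c - d) = mat_of_cols n bs *\<^sub>v c - mat_of_cols n bs *\<^sub>v d"
      by (rule mult_minus_distrib_mat_vec[OF mat_of_cols_carrier(1) c d])
    also have "\<dots> = 0\<^sub>v n" unfolding eq by auto
    finally have z: "c - d = 0\<^sub>v (length bs)" using assms c d unfolding indep_list_def by auto
    show "c = d"
    proof (rule eq_vecI)
      fix i assume "i < dim_vec d"
      then show "c $ i = d $ i" using arg_cong[OF z, of "\<lambda>x. x $ i"] c d by auto
    qed (use c d in auto)
  qed
  then show ?thesis unfolding combinations_def by (simp add: card_image card_carrier_vec)
qed

text \<open>
  An independent list of length \<open>k\<close> has \<open>q ^ k\<close> distinct linear combinations, so
  \<open>q ^ n - q ^ k\<close> vectors extend it.  Over the integers this also covers \<open>k > n\<close>, where the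
  factor for \<open>i = n\<close> is zero and there are no independent lists.
\<close>
lemma card_indep_lists:
  "int (card {bs :: 'a::{finite,field} vec list. length bs = k \<and> indep_list n bs}) =
    (\<Prod>i<k. int CARD('a) ^ n - int CARD('a) ^ i)"
proof (induction k)
  case 0
  have "{bs :: 'a vec list. length bs = 0 \<and> indep_list n bs} = {[]}"
    by (auto simp: indep_list_def)
  then show ?case by simp
next
  case (Suc k)
  let ?I = "\<lambda>k. {bs :: 'a vec list. length bs = k \<and> indep_list n bs}"
  let ?ext = "\<lambda>bs :: 'a vec list. carrier_vec n - combinations n bs"
  have fin: "finite (?I k)"
    by (rule finite_subset[OF _ finite_lists_length_eq[OF finite_carrier_vec, of n k]])
      (auto simp: indep_list_def)
  have "?I (Suc k) = (\<lambda>(bs, v). v # bs) ` Sigma (?I k) ?ext"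
  proof (intro Set.set_eqI iffI)
    fix xs :: "'a vec list" assume "xs \<in> ?I (Suc k)"
    then show "xs \<in> (\<lambda>(bs, v). v # bs) ` Sigma (?I k) ?ext"
      by (cases xs) (auto simp: indep_list_Cons)
  qed (auto simp: indep_list_Cons)
  moreover have "inj_on (\<lambda>(bs, v). v # bs) (Sigma (?I k) ?ext)" by (auto simp: inj_on_def)
  ultimately have "card (?I (Suc k)) = card (Sigma (?I k) ?ext)" by (simp add: card_image)
  also have "\<dots> = (\<Sum>bs \<in> ?I k. card (?ext bs))"
    by (rule card_SigmaI) (use fin in auto)
  also have "int \<dots> = (\<Sum>bs \<in> ?I k. int CARD('a) ^ n - int CARD('a) ^ k)"
    unfolding of_nat_sum
  proof (rule sum.cong[OF refl])
    fix bs assume bs: "bs \<in> ?I k"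
    have sub: "combinations n bs \<subseteq> carrier_vec n"
      unfolding combinations_def using mult_mat_vec_carrier[OF mat_of_cols_carrier(1)] by blast
    then have "card (combinations n bs) \<le> card (carrier_vec n :: 'a vec set)"
      by (intro card_mono) auto
    with card_Diff_subset[OF finite_subset[OF sub] sub]
    show "int (card (?ext bs)) = int CARD('a) ^ n - int CARD('a) ^ k"
      using bs by (simp add: card_combinations card_carrier_vec of_nat_diff)
  qed
  also have "\<dots> = (\<Prod>i<Suc k. int CARD('a) ^ n - int CARD('a) ^ i)"
    using Suc.IH by simp
  finally show ?case .
qed

section \<open>Polynomials in a matrix acting on a vector\<close>

definition iter :: "'a::field mat \<Rightarrow> 'a vec \<Rightarrow> nat \<Rightarrow> 'a vec" where
  "iter A v i = ((\<lambda>u. A *\<^sub>v u) ^^ i) v"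

text \<open>
  The coefficients form a sequence and the length \<open>k\<close> is free, so that one polynomial can be
  read with any degree bound; a sum of polynomials is compared with its summands at a common length.
\<close>
definition iter_sum :: "'a::field mat \<Rightarrow> 'a vec \<Rightarrow> (nat \<Rightarrow> 'a) \<Rightarrow> nat \<Rightarrow> 'a vec" where
  "iter_sum A v c k = vec (dim_vec v) (\<lambda>r. \<Sum>i<k. c i * iter A v i $ r)"

definition poly_act :: "'a::field mat \<Rightarrow> 'a vec \<Rightarrow> 'a poly \<Rightarrow> 'a vec" where
  "poly_act A v p = iter_sum A v (coeff p) (Suc (degree p))"

lemma iter_0 [simp]: "iter A v 0 = v"
  and iter_Suc: "iter A v (Suc i) = A *\<^sub>v iter A v i"
  by (simp_all add: iter_def)

lemma iter_carrier [simp]: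
  assumes "A \<in> carrier_mat n n" "v \<in> carrier_vec n"
  shows "iter A v i \<in> carrier_vec n"
  using assms by (induction i) (auto simp: iter_Suc)

lemma iter_mult: "iter A (A *\<^sub>v v) i = iter A v (Suc i)"
  by (induction i) (simp_all add: iter_Suc)

lemma iter_add:
  assumes "A \<in> carrier_mat n n" "v \<in> carrier_vec n" "w \<in> carrier_vec n"
  shows "iter A (v + w) i = iter A v i + iter A w i"
  using assms by (induction i) (simp_all add: iter_Suc mult_add_distrib_mat_vec[OF assms(1)])

lemma iter_smult:
  assumes "A \<in> carrier_mat n n" "v \<in> carrier_vec n"
  shows "iter A (a \<cdot>\<^sub>v v) i = a \<cdot>\<^sub>v iter A v i"
  using assms by (induction i) (simp_all add: iter_Suc mult_mat_vec[OF assms(1)])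

lemma iter_zero:
  assumes "A \<in> carrier_mat n n"
  shows "iter A (0\<^sub>v n) i = 0\<^sub>v n"
  using assms by (induction i) (auto simp: iter_Suc)

lemma iter_sum_Suc:
  assumes "A \<in> carrier_mat n n" "v \<in> carrier_vec n"
  shows "iter_sum A v c (Suc k) = iter_sum A v c k + c k \<cdot>\<^sub>v iter A v k"
proof (rule eq_vecI)
  have d: "dim_vec (iter A v k) = n" using iter_carrier[OF assms, of k] by simp
  fix r assume "r < dim_vec (iter_sum A v c k + c k \<cdot>\<^sub>v iter A v k)"
  then have "r < n" using d by simp
  moreover have "(iter_sum A v c k + c k \<cdot>\<^sub>v iter A v k) $ r =
      iter_sum A v c k $ r + c k * iter A v k $ r"
    using d \<open>r < n\<close> by simp
  ultimately show "iter_sum A v c (Suc k) $ r = (iter_sum A v c k + c k \<cdot>\<^sub>v iter A v k) $ r"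
    using assms by (simp add: iter_sum_def)
qed (simp add: iter_sum_def carrier_vecD[OF iter_carrier[OF assms]] carrier_vecD[OF assms(2)])

text \<open>
  This turns linear relations among the iterates of \<open>v\<close> into polynomials annihilating \<open>v\<close>.
\<close>
lemma mat_of_cols_iter:
  assumes "A \<in> carrier_mat n n" "v \<in> carrier_vec n"
  shows "mat_of_cols n (map (iter A v) [0..<k]) *\<^sub>v vec k c = iter_sum A v c k"
proof (rule eq_vecI)
  fix r assume "r < dim_vec (iter_sum A v c k)"
  then have r: "r < n" using assms by (simp add: iter_sum_def)
  have "(mat_of_cols n (map (iter A v) [0..<k]) *\<^sub>v vec k c) $ r =
     (\<Sum>s<k. mat_of_cols n (map (iter A v) [0..<k]) $$ (r, s) * vec k c $ s)"
    by (rule mult_mat_vec_index_sum)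
      (use r mat_of_cols_carrier(1)[of n "map (iter A v) [0..<k]"] in auto)
  also have "\<dots> = iter_sum A v c k $ r"
    using r assms by (simp add: iter_sum_def mat_of_cols_index mult.commute)
  finally show "(mat_of_cols n (map (iter A v) [0..<k]) *\<^sub>v vec k c) $ r = iter_sum A v c k $ r" .
qed (use assms in \<open>auto simp: iter_sum_def\<close>)

lemma poly_act_eq_iter_sum:
  assumes "degree p < k"
  shows "poly_act A v p = iter_sum A v (coeff p) k"
proof -
  have "(\<Sum>i<k. coeff p i * iter A v i $ r) = (\<Sum>i<Suc (degree p). coeff p i * iter A v i $ r)" for r
    by (rule sum.mono_neutral_right) (use assms in \<open>auto simp: coeff_eq_0\<close>)
  then show ?thesis by (simp add: poly_act_def iter_sum_def)
qed

lemma poly_act_carrier [simp]: "v \<in> carrier_vec n \<Longrightarrow> poly_act A v p \<in> carrier_vec n"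
  by (simp add: poly_act_def iter_sum_def)

lemma poly_act_0: "v \<in> carrier_vec n \<Longrightarrow> poly_act A v 0 = 0\<^sub>v n"
  by (auto simp: poly_act_def iter_sum_def)

lemma poly_act_add: "poly_act A v (p + q) = poly_act A v p + poly_act A v q"
proof -
  define k where "k = Suc (max (degree p) (degree q))"
  have "degree p < k" "degree q < k" "degree (p + q) < k"
    using degree_add_le_max[of p q] by (auto simp: k_def)
  then show ?thesis
    by (auto simp: poly_act_eq_iter_sum iter_sum_def ring_distribs sum.distrib)
qed

lemma poly_act_smult: "poly_act A v (smult a p) = a \<cdot>\<^sub>v poly_act A v p"
proof -
  have "poly_act A v (smult a p) = iter_sum A v (coeff (smult a p)) (Suc (degree p))"
    by (rule poly_act_eq_iter_sum) simp
  also have "\<dots> = a \<cdot>\<^sub>v poly_act A v p"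
    by (intro eq_vecI)
      (simp_all add: poly_act_def iter_sum_def sum_distrib_left mult.assoc del: sum.lessThan_Suc)
  finally show ?thesis .
qed

text \<open>
  Multiplication by the indeterminate acts as \<open>A\<close>.  Together with additivity and homogeneity this
  makes the annihilators of \<open>v\<close> an ideal.
\<close>
lemma poly_act_pCons_0:
  assumes A: "A \<in> carrier_mat n n" and v: "v \<in> carrier_vec n"
  shows "poly_act A v (pCons 0 p) = A *\<^sub>v poly_act A v p"
proof (rule eq_vecI)
  fix r assume "r < dim_vec (A *\<^sub>v poly_act A v p)"
  then have r: "r < n" using A by simp
  let ?k = "Suc (degree p)"
  have "poly_act A v (pCons 0 p) $ r = (\<Sum>i<Suc ?k. coeff (pCons 0 p) i * iter A v i $ r)"
    using r v degree_pCons_le[of 0 p]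
    by (subst poly_act_eq_iter_sum[of _ "Suc ?k"]) (auto simp: iter_sum_def)
  also have "\<dots> = (\<Sum>i<?k. coeff p i * iter A v (Suc i) $ r)"
    unfolding sum.lessThan_Suc_shift by simp
  also have "\<dots> = (\<Sum>i<?k. \<Sum>s<n. coeff p i * (A $$ (r, s) * iter A v i $ s))"
    unfolding iter_Suc sum_distrib_left[symmetric]
    by (intro sum.cong refl arg_cong2[where f = "(*)"] mult_mat_vec_index_sum[OF A _ r]) (use A v in auto)
  also have "\<dots> = (\<Sum>s<n. A $$ (r, s) * (\<Sum>i<?k. coeff p i * iter A v i $ s))"
    by (subst sum.swap) (simp only: sum_distrib_left mult.left_commute)
  also have "\<dots> = (\<Sum>s<n. A $$ (r, s) * poly_act A v p $ s)"
    using v by (simp add: poly_act_def iter_sum_def del: sum.lessThan_Suc)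
  also have "\<dots> = (A *\<^sub>v poly_act A v p) $ r"
    by (rule mult_mat_vec_index_sum[symmetric]) (use A v r in auto)
  finally show "poly_act A v (pCons 0 p) $ r = (A *\<^sub>v poly_act A v p) $ r" .
qed (use A v in \<open>auto simp: poly_act_def iter_sum_def\<close>)

lemma poly_act_mult_annihilator:
  assumes A: "A \<in> carrier_mat n n" and v: "v \<in> carrier_vec n" and p: "poly_act A v p = 0\<^sub>v n"
  shows "poly_act A v (q * p) = 0\<^sub>v n"
proof (induction q)
  case 0
  show ?case using poly_act_0[OF v] by simp
next
  case (pCons a q)
  then show ?case
    using A v p by (auto simp: poly_act_add poly_act_smult poly_act_pCons_0)
qed

text \<open>
  The Cayley-Hamilton theorem, applied to a vector.  Let \<open>B = \<Sum>k. x ^ k B\<^sub>k\<close> be the adjugate of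
  \<open>x I - A\<close>, so \<open>(x I - A) B = f I\<close>, and put \<open>w\<^sub>k = B\<^sub>k v\<close>.  Comparing coefficients gives
  \<open>f\<^sub>0 v = - A w\<^sub>0\<close> and \<open>f\<^sub>k\<^sub>+\<^sub>1 v = w\<^sub>k - A w\<^sub>k\<^sub>+\<^sub>1\<close>.  Apply \<open>A ^ i\<close> to
  the equation for \<open>f\<^sub>i v\<close> and add for \<open>i \<le> k\<close>: the sum telescopes to \<open>- A ^ (k + 1) w\<^sub>k\<close>,
  which is zero once \<open>k\<close> exceeds all degrees in \<open>B\<close>.
\<close>

lemma poly_act_char_poly:
  fixes A :: "'a::field mat"
  assumes A: "A \<in> carrier_mat n n" and v: "v \<in> carrier_vec n"
  shows "poly_act A v (char_poly A) = 0\<^sub>v n"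
proof -
  define f where "f = char_poly A"
  define M where "M = char_poly_matrix A"
  define B where "B = adj_mat M"
  define w where "w k = map_mat (\<lambda>p. coeff p k) B *\<^sub>v v" for k
  have M: "M \<in> carrier_mat n n" using A by (simp add: M_def)
  have B: "B \<in> carrier_mat n n" and MB: "M * B = f \<cdot>\<^sub>m 1\<^sub>m n"
    using adj_mat[OF M] by (auto simp: B_def f_def M_def char_poly_def)
  have w: "w k \<in> carrier_vec n" for k using B v by (simp add: w_def)
  have w_index: "w k $ r = (\<Sum>j<n. coeff (B $$ (r, j)) k * v $ j)" if "r < n" for k r
  proof -
    have "w k $ r = (\<Sum>j<n. map_mat (\<lambda>p. coeff p k) B $$ (r, j) * v $ j)"
      unfolding w_def by (rule mult_mat_vec_index_sum) (use B v that in auto)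
    then show ?thesis using B that by simp
  qed
  (* The (r, j) entry of x B = f I + A B. *)
  have entry: "pCons 0 (B $$ (r, j)) =
      (if r = j then f else 0) + (\<Sum>l<n. smult (A $$ (r, l)) (B $$ (l, j)))"
    if r: "r < n" and j: "j < n" for r j
  proof -
    have "(if r = j then f else 0) = (M * B) $$ (r, j)" unfolding MB using r j by simp
    also have "\<dots> = (\<Sum>l<n. M $$ (r, l) * B $$ (l, j))"
      using M B r j by (auto simp: scalar_prod_def atLeast0LessThan intro!: sum.cong)
    also have "\<dots> = (\<Sum>l<n. (if l = r then pCons 0 (B $$ (l, j)) else 0)
        - smult (A $$ (r, l)) (B $$ (l, j)))"
      using A r j by (intro sum.cong) (auto simp: M_def char_poly_matrix_def algebra_simps)
    also have "\<dots> = pCons 0 (B $$ (r, j)) - (\<Sum>l<n. smult (A $$ (r, l)) (B $$ (l, j)))"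
      using r by (simp add: sum_subtractf)
    finally show ?thesis by simp
  qed
  have entry_vec: "(\<Sum>j<n. coeff (pCons 0 (B $$ (r, j))) k * v $ j) =
      coeff f k * v $ r + (A *\<^sub>v w k) $ r" if r: "r < n" for r k
  proof -
    have "(\<Sum>j<n. coeff (pCons 0 (B $$ (r, j))) k * v $ j) =
        (\<Sum>j<n. (if j = r then coeff f k * v $ j else 0) +
           (\<Sum>l<n. A $$ (r, l) * (coeff (B $$ (l, j)) k * v $ j)))"
      by (intro sum.cong refl)
        (auto simp: entry[OF r] coeff_sum sum_distrib_right ring_distribs mult.assoc)
    also have "\<dots> = coeff f k * v $ r +
        (\<Sum>j<n. \<Sum>l<n. A $$ (r, l) * (coeff (B $$ (l, j)) k * v $ j))"
      using r by (simp add: sum.distrib)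
    also have "(\<Sum>j<n. \<Sum>l<n. A $$ (r, l) * (coeff (B $$ (l, j)) k * v $ j)) =
        (\<Sum>l<n. A $$ (r, l) * w k $ l)"
      by (subst sum.swap) (simp add: w_index sum_distrib_left)
    also have "\<dots> = (A *\<^sub>v w k) $ r"
      by (rule mult_mat_vec_index_sum[symmetric]) (use A w r in auto)
    finally show ?thesis .
  qed
  have base: "coeff f 0 \<cdot>\<^sub>v v + A *\<^sub>v w 0 = 0\<^sub>v n"
    using entry_vec[of _ 0] A v by (intro eq_vecI) auto
  have step: "coeff f (Suc k) \<cdot>\<^sub>v v + A *\<^sub>v w (Suc k) = w k" for k
    using entry_vec[of _ "Suc k"] A v w[of k] by (intro eq_vecI) (auto simp: w_index)
  have telescope: "iter_sum A v (coeff f) (Suc k) + iter A (w k) (Suc k) = 0\<^sub>v n" for k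
  proof (induction k)
    case 0
    have "iter_sum A v (coeff f) (Suc 0) = coeff f 0 \<cdot>\<^sub>v v"
      using v by (intro eq_vecI) (auto simp: iter_sum_def)
    then show ?case using base by (simp add: iter_Suc)
  next
    case (Suc k)
    have c: "iter_sum A v (coeff f) m \<in> carrier_vec n" for m using v by (simp add: iter_sum_def)
    have "iter_sum A v (coeff f) (Suc (Suc k)) =
        iter_sum A v (coeff f) (Suc k) + coeff f (Suc k) \<cdot>\<^sub>v iter A v (Suc k)"
      by (rule iter_sum_Suc[OF A v])
    then have "iter_sum A v (coeff f) (Suc (Suc k)) + iter A (w (Suc k)) (Suc (Suc k)) =
        iter_sum A v (coeff f) (Suc k) +
          (coeff f (Suc k) \<cdot>\<^sub>v iter A v (Suc k) + iter A (A *\<^sub>v w (Suc k)) (Suc k))"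
      using A v w c by (simp add: iter_mult assoc_add_vec[of _ n])
    also have "coeff f (Suc k) \<cdot>\<^sub>v iter A v (Suc k) + iter A (A *\<^sub>v w (Suc k)) (Suc k) =
        iter A (w k) (Suc k)"
      unfolding step[of k, symmetric] using A v w by (simp add: iter_add[OF A] iter_smult[OF A])
    finally show ?case using Suc.IH by simp
  qed
  define N where "N = Max (insert (degree f) ((\<lambda>(r, j). degree (B $$ (r, j))) ` ({..<n} \<times> {..<n})))"
  have "degree f \<le> N" unfolding N_def by (rule Max_ge) auto
  have dB: "degree (B $$ (r, j)) \<le> N" if "r < n" "j < n" for r j
    unfolding N_def by (rule Max_ge) (use that in auto)
  have "w (Suc N) = 0\<^sub>v n"
    using w[of "Suc N"] dB by (intro eq_vecI) (auto simp: w_index coeff_eq_0 le_imp_less_Suc)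
  with telescope[of "Suc N"] have "iter_sum A v (coeff f) (Suc (Suc N)) = 0\<^sub>v n"
    using v iter_zero[OF A] by (simp add: iter_sum_def)
  then show ?thesis
    using \<open>degree f \<le> N\<close> by (simp add: f_def[symmetric] poly_act_eq_iter_sum[of _ "Suc (Suc N)"])
qed

section \<open>Cyclic vectors\<close>

text \<open>
  A relation among the first \<open>k\<close> iterates of \<open>v\<close> is an annihilating polynomial of degree below \<open>k\<close>.
\<close>
lemma indep_iter_iff:
  assumes A: "A \<in> carrier_mat n n" and v: "v \<in> carrier_vec n"
  shows "indep_list n (map (iter A v) [0..<k]) \<longleftrightarrow>
    (\<forall>p. poly_act A v p = 0\<^sub>v n \<longrightarrow> p \<noteq> 0 \<longrightarrow> k \<le> degree p)" (is "?L \<longleftrightarrow> ?R")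
proof
  assume L: ?L
  show ?R
  proof (intro allI impI, rule ccontr)
    fix p assume p: "poly_act A v p = 0\<^sub>v n" "p \<noteq> 0" "\<not> k \<le> degree p"
    then have "mat_of_cols n (map (iter A v) [0..<k]) *\<^sub>v vec k (coeff p) = 0\<^sub>v n"
      by (simp add: mat_of_cols_iter[OF A v] poly_act_eq_iter_sum[of _ k])
    with L have "vec k (coeff p) = 0\<^sub>v k" by (simp add: indep_list_def)
    from arg_cong[OF this, of "\<lambda>x. x $ degree p"] p show False by simp
  qed
next
  assume R: ?R
  have "c = 0\<^sub>v k" if c: "c \<in> carrier_vec k"
    and z: "mat_of_cols n (map (iter A v) [0..<k]) *\<^sub>v c = 0\<^sub>v n" for c
  proof (cases "k = 0")
    case True
    then show ?thesis using c by auto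
  next
    case False
    define p where "p = Poly (list_of_vec c)"
    have coeff_p: "coeff p i = (if i < k then c $ i else 0)" for i
      using c by (auto simp: p_def nth_default_def list_of_vec_index)
    have "degree p < k"
      using False coeff_p by (metis leading_coeff_0_iff degree_0 neq0_conv)
    moreover have c_eq: "c = vec k (coeff p)" using c by (intro eq_vecI) (auto simp: coeff_p)
    ultimately have "poly_act A v p = 0\<^sub>v n"
      using z by (metis mat_of_cols_iter[OF A v] poly_act_eq_iter_sum)
    with R \<open>degree p < k\<close> have "p = 0" by (meson not_le)
    then show ?thesis using c_eq by auto
  qed
  then show ?L using A v by (auto simp: indep_list_def)
qed

text \<open>
  A nonzero annihilator \<open>g\<close> of \<open>v\<close> of least degree divides every other annihilator, in particular
  the characteristic polynomial.  By irreducibility \<open>g\<close> is a nonzero constant, which is impossible for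
  \<open>v \<noteq> 0\<close>, or has degree \<open>n\<close>.
\<close>
lemma irreducible_char_poly_cyclic:
  assumes A: "A \<in> carrier_mat n n" and v: "v \<in> carrier_vec n" "v \<noteq> 0\<^sub>v n"
    and irr: "irreducible (char_poly A)"
  shows "indep_list n (map (iter A v) [0..<n])"
  unfolding indep_iter_iff[OF A v(1)]
proof (intro allI impI)
  fix p assume p: "poly_act A v p = 0\<^sub>v n" "p \<noteq> 0"
  let ?ann = "\<lambda>p. poly_act A v p = 0\<^sub>v n \<and> p \<noteq> 0"
  let ?f = "char_poly A"
  obtain g where g: "?ann g" and least: "\<And>h. ?ann h \<Longrightarrow> degree g \<le> degree h"
    using p by (metis (mono_tags, lifting) ex_has_least_nat[of ?ann p degree])
  have "poly_act A v (?f mod g) = 0\<^sub>v n"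
  proof -
    have "?f mod g = ?f + (- (?f div g)) * g" by (simp add: minus_div_mult_eq_mod[symmetric])
    then show ?thesis
      using poly_act_char_poly[OF A v(1)] poly_act_mult_annihilator[OF A v(1)] g
      by (simp add: poly_act_add del: mult_minus_left)
  qed
  then have "?f mod g = 0"
    using least[of "?f mod g"] g degree_mod_less'[of g ?f] by (metis not_le)
  then obtain h where h: "?f = g * h" by (metis dvd_def mod_eq_0_iff_dvd)
  from irreducibleD[OF irr h] show "n \<le> degree p"
  proof
    assume "g dvd 1"
    then have "degree g = 0" using g by auto
    then obtain a where a: "g = [:a:]" "a \<noteq> 0" using g by (metis degree_eq_zeroE pCons_0_0)
    have "poly_act A v g = a \<cdot>\<^sub>v v" using a v(1)
      by (intro eq_vecI) (auto simp: poly_act_def iter_sum_def)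
    then have "a \<cdot>\<^sub>v v = 0\<^sub>v n" using g by simp
    then have "v $ i = 0" if "i < n" for i
    proof -
      have "a * v $ i = (a \<cdot>\<^sub>v v) $ i" using v(1) that by simp
      also have "\<dots> = 0" using \<open>a \<cdot>\<^sub>v v = 0\<^sub>v n\<close> that by simp
      finally show ?thesis using a(2) by simp
    qed
    then have "v = 0\<^sub>v n" using v(1) by (intro eq_vecI) auto
    then show ?thesis using v by simp
  next
    assume "h dvd 1"
    then have "degree h = 0" "h \<noteq> 0" by (auto simp: is_unit_poly_iff)
    then have "degree ?f = degree g" using h g by (simp add: degree_mult_eq)
    then show ?thesis using least p degree_monic_char_poly[OF A] by simp
  qed
qed

text \<open>
  Both polynomials are monic of degree \<open>n\<close> and annihilate \<open>v\<close>; their difference has smaller degree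
  and annihilates a cyclic vector.
\<close>
lemma char_poly_eq_cyclic_annihilator:
  assumes A: "A \<in> carrier_mat n n" and v: "v \<in> carrier_vec n"
    and ind: "indep_list n (map (iter A v) [0..<n])"
    and f: "monic f" "degree f = n" "poly_act A v f = 0\<^sub>v n"
  shows "char_poly A = f"
proof (rule ccontr)
  let ?g = "char_poly A + smult (- 1) f"
  assume "char_poly A \<noteq> f"
  then have nz: "?g \<noteq> 0" by simp
  have "poly_act A v ?g = 0\<^sub>v n"
    unfolding poly_act_add poly_act_smult f(3) poly_act_char_poly[OF A v] by auto
  with ind nz have "n \<le> degree ?g" unfolding indep_iter_iff[OF A v] by blast
  moreover have "degree ?g \<le> n"
    using degree_monic_char_poly[OF A] f by (intro degree_add_le) auto
  ultimately have "degree ?g = n" by simp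
  moreover have "coeff ?g n = 0" using degree_monic_char_poly[OF A] f by simp
  ultimately show False using nz by (metis leading_coeff_0_iff)
qed

lemma indep_list_inverse:
  fixes bs :: "'a::field vec list"
  assumes "indep_list n bs" "length bs = n"
  obtains R where "R \<in> carrier_mat n n" "mat_of_cols n bs * R = 1\<^sub>m n" "R * mat_of_cols n bs = 1\<^sub>m n"
proof -
  let ?P = "mat_of_cols n bs"
  have P: "?P \<in> carrier_mat n n" using assms(2) mat_of_cols_carrier(1)[of n bs] by simp
  have "det ?P \<noteq> 0"
    unfolding det_0_iff_vec_prod_zero_field[OF P] using assms by (auto simp: indep_list_def)
  from det_non_zero_imp_unit[OF P this, unfolded Units_def, of "()"] that show thesis
    by (auto simp: ring_mat_def)
qed

lemma mat_mult_mat_of_cols: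
  assumes A: "A \<in> carrier_mat n n" and bs: "set bs \<subseteq> carrier_vec n"
  shows "A * mat_of_cols n bs = mat_of_cols n (map (\<lambda>b. A *\<^sub>v b) bs)"
proof (rule eq_matI)
  fix i j assume "i < dim_row (mat_of_cols n (map (\<lambda>b. A *\<^sub>v b) bs))"
    "j < dim_col (mat_of_cols n (map (\<lambda>b. A *\<^sub>v b) bs))"
  then have ij: "i < n" "j < length bs" by auto
  then have "bs ! j \<in> carrier_vec n" using bs by auto
  then show "(A * mat_of_cols n bs) $$ (i, j) = mat_of_cols n (map (\<lambda>b. A *\<^sub>v b) bs) $$ (i, j)"
    using A ij by (simp add: mat_of_cols_index)
qed (use A in auto)

lemma mat_eq_on_indep_list:
  assumes A: "A \<in> carrier_mat n n" and B: "B \<in> carrier_mat n n"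
    and bs: "indep_list n bs" "length bs = n"
    and eq: "\<And>b. b \<in> set bs \<Longrightarrow> A *\<^sub>v b = B *\<^sub>v b"
  shows "A = B"
proof -
  let ?P = "mat_of_cols n bs"
  obtain R where R: "R \<in> carrier_mat n n" "?P * R = 1\<^sub>m n"
    using indep_list_inverse[OF bs] by metis
  have P: "?P \<in> carrier_mat n n" using bs(2) mat_of_cols_carrier(1)[of n bs] by simp
  have "set bs \<subseteq> carrier_vec n" using bs(1) by (simp add: indep_list_def)
  then have "A * ?P = B * ?P"
    using eq by (simp add: mat_mult_mat_of_cols[OF A] mat_mult_mat_of_cols[OF B] cong: map_cong)
  then have "(A * ?P) * R = (B * ?P) * R" by simp
  then show ?thesis using A B P R by simp
qed

lemma mat_prescribed_on_indep_list:
  assumes bs: "indep_list n bs" "length bs = n"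
    and cs: "set cs \<subseteq> carrier_vec n" "length cs = n"
  obtains A where "A \<in> carrier_mat n n" "\<forall>i<n. A *\<^sub>v (bs ! i) = cs ! i"
proof -
  let ?P = "mat_of_cols n bs" and ?Q = "mat_of_cols n cs"
  obtain R where R: "R \<in> carrier_mat n n" "R * ?P = 1\<^sub>m n"
    using indep_list_inverse[OF bs] by metis
  have P: "?P \<in> carrier_mat n n" using bs(2) mat_of_cols_carrier(1)[of n bs] by simp
  have Q: "?Q \<in> carrier_mat n n" using cs(2) mat_of_cols_carrier(1)[of n cs] by simp
  have sub: "set bs \<subseteq> carrier_vec n" using bs(1) by (simp add: indep_list_def)
  let ?A = "?Q * R"
  have A: "?A \<in> carrier_mat n n" using Q R by simp
  have "?A * ?P = ?Q" using right_mult_one_mat[OF Q] Q R P by simp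
  then have eq: "mat_of_cols n (map (\<lambda>b. ?A *\<^sub>v b) bs) = ?Q"
    by (simp add: mat_mult_mat_of_cols[OF A sub])
  show thesis
  proof (rule that[OF A], intro allI impI)
    fix i assume i: "i < n"
    then have "cs ! i \<in> carrier_vec n" "bs ! i \<in> carrier_vec n" using cs bs sub by auto
    then show "?A *\<^sub>v (bs ! i) = cs ! i"
      using arg_cong[OF eq, of "\<lambda>M. col M i"] i A bs cs by simp
  qed
qed

section \<open>Pairs of a matrix and a cyclic vector as bases\<close>

text \<open>
  Two pairs with the same iterates \<open>A ^ i v\<close> for \<open>i < n\<close> also agree at \<open>i = n\<close>, because
  \<open>f(A) v = 0\<close> expresses that iterate through the earlier ones; so the two matrices agree on a
  basis.  For surjectivity the same relation prescribes the matrix on the given basis.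
\<close>
lemma bij_betw_cyclic_pairs_bases:
  fixes f :: "'a::field poly"
  assumes n: "n \<ge> 1" and f: "monic f" "irreducible f" "degree f = n"
  shows "bij_betw (\<lambda>(A, v). map (iter A v) [0..<n])
    ({A \<in> carrier_mat n n. char_poly A = f} \<times> (carrier_vec n - {0\<^sub>v n}))
    {bs. length bs = n \<and> indep_list n bs}"
  (is "bij_betw ?\<phi> (?X \<times> ?V) ?I")
proof (rule bij_betw_imageI)
  have act: "poly_act A v f = iter_sum A v (coeff f) n + iter A v n"
    if "A \<in> carrier_mat n n" "v \<in> carrier_vec n" for A v
    using f iter_carrier[OF that] by (simp add: poly_act_def iter_sum_Suc[OF that])
  have sum_cong: "iter_sum A v c n = iter_sum B v c n"
    if "\<And>i. i < n \<Longrightarrow> iter A v i = iter B v i" for A B v c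
    using that by (auto simp: iter_sum_def)
  show "inj_on ?\<phi> (?X \<times> ?V)"
  proof (rule inj_onI)
    fix x y assume xy: "x \<in> ?X \<times> ?V" "y \<in> ?X \<times> ?V" "?\<phi> x = ?\<phi> y"
    obtain A v where x: "x = (A, v)" by fastforce
    obtain B w where y: "y = (B, w)" by fastforce
    have A: "A \<in> carrier_mat n n" and B: "B \<in> carrier_mat n n"
      and v: "v \<in> carrier_vec n" "v \<noteq> 0\<^sub>v n"
      and fA: "char_poly A = f" and fB: "char_poly B = f"
      and eq: "map (iter A v) [0..<n] = map (iter B w) [0..<n]"
      using xy by (auto simp: x y)
    from eq have it: "iter A v i = iter B w i" if "i < n" for i using that by simp
    from it[of 0] n have vw: "w = v" by simp
    have zero: "iter_sum A v (coeff f) n + iter A v n = 0\<^sub>v n"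
      "iter_sum A v (coeff f) n + iter B v n = 0\<^sub>v n"
      using act[OF A v(1)] act[OF B v(1)] poly_act_char_poly[OF A v(1)] poly_act_char_poly[OF B v(1)]
        sum_cong[of A v B "coeff f"] it fA fB vw by simp_all
    have it_n: "iter A v n = iter B v n"
    proof (rule eq_vecI)
      fix r assume "r < dim_vec (iter B v n)"
      then have r: "r < n" using iter_carrier[OF B v(1), of n] by simp
      from zero[THEN arg_cong, of "\<lambda>x. x $ r"] r
      show "iter A v n $ r = iter B v n $ r"
        using iter_carrier[OF A v(1), of n] iter_carrier[OF B v(1), of n] v(1)
        by (auto simp: iter_sum_def) (metis add_left_cancel)
    qed (use iter_carrier[OF A v(1), of n] iter_carrier[OF B v(1), of n] in auto)
    have "A = B"
    proof (rule mat_eq_on_indep_list[OF A B irreducible_char_poly_cyclic[OF A v]])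
      show "irreducible (char_poly A)" using f fA by simp
      fix b assume "b \<in> set (map (iter A v) [0..<n])"
      then obtain i where i: "i < n" "b = iter A v i" by auto
      have "iter A v (Suc i) = iter B v (Suc i)"
        using it[of "Suc i"] it_n i vw by (cases "Suc i = n") auto
      then show "A *\<^sub>v b = B *\<^sub>v b" using i it[of i] vw by (simp add: iter_Suc)
    qed simp
    with vw show "x = y" by (simp add: x y)
  qed
  show "?\<phi> ` (?X \<times> ?V) = ?I"
  proof (intro Set.set_eqI iffI)
    fix bs assume "bs \<in> ?\<phi> ` (?X \<times> ?V)"
    then show "bs \<in> ?I" using irreducible_char_poly_cyclic f(2) by auto
  next
    fix bs :: "'a vec list" assume "bs \<in> ?I"
    then have len: "length bs = n" and ind: "indep_list n bs" by auto
    then have bs: "set bs \<subseteq> carrier_vec n" by (simp add: indep_list_def)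
    define v where "v = bs ! 0"
    (* The image of the last basis vector, forced by f(A) v = 0 and f being monic. *)
    define z where "z = - (mat_of_cols n bs *\<^sub>v vec n (coeff f))"
    have "bs ! 0 \<in> set bs" using n len by (intro nth_mem) simp
    then have v: "v \<in> carrier_vec n" unfolding v_def by (rule subsetD[OF bs])
    have z: "z \<in> carrier_vec n" by (rule carrier_vecI) (simp add: z_def)
    have "set (tl bs @ [z]) \<subseteq> carrier_vec n" using bs z by (cases bs) auto
    moreover have "length (tl bs @ [z]) = n" using len n by simp
    ultimately obtain A where A: "A \<in> carrier_mat n n"
      and Ab: "\<forall>i<n. A *\<^sub>v (bs ! i) = (tl bs @ [z]) ! i"
      by (rule mat_prescribed_on_indep_list[OF ind len])
    have it: "iter A v i = bs ! i" if "i < n" for i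
      using that
    proof (induction i)
      case (Suc i)
      then have "i < n - 1" by simp
      then have "(tl bs @ [z]) ! i = bs ! Suc i" using len by (simp add: nth_append nth_tl)
      with Suc Ab show ?case by (simp add: iter_Suc)
    qed (simp add: v_def)
    have map_it: "map (iter A v) [0..<n] = bs" using it len by (intro nth_equalityI) auto
    have "iter A v n = z"
    proof -
      obtain m where m: "n = Suc m" using n by (cases n) auto
      then have "(tl bs @ [z]) ! m = z" using len by (simp add: nth_append)
      with m it[of m] Ab show ?thesis by (simp add: iter_Suc)
    qed
    then have "poly_act A v f = 0\<^sub>v n"
      unfolding act[OF A v] mat_of_cols_iter[OF A v, symmetric] map_it z_def by auto
    then have "char_poly A = f"
      using char_poly_eq_cyclic_annihilator[OF A v] ind f map_it by simp
    moreover have "v \<noteq> 0\<^sub>v n"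
    proof
      assume v0: "v = 0\<^sub>v n"
      then have "poly_act A v 1 = 0\<^sub>v n"
        by (auto simp: poly_act_def iter_sum_def)
      then show False using ind n unfolding map_it[symmetric] indep_iter_iff[OF A v] by force
    qed
    ultimately show "bs \<in> ?\<phi> ` (?X \<times> ?V)"
      using A v map_it by (intro image_eqI[of _ _ "(A, v)"]) auto
  qed
qed

theorem theorem1:
  fixes f :: "'a :: {finite, field} poly" and n q :: nat
  assumes "CARD('a) = q"
    and "n \<ge> 1"
    and "monic f"
    and "irreducible f"
    and "degree f = n"
  shows "int (card {A \<in> carrier_mat n n. char_poly A = f}) = (\<Prod>i = 1..n - 1. int q ^ n - int q ^ i)"
proof -
  let ?X = "{A \<in> carrier_mat n n. char_poly A = f}"
  let ?V = "carrier_vec n - {0\<^sub>v n :: 'a vec}"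
  have "card {0, 1 :: 'a} \<le> CARD('a)" by (rule card_mono) auto
  then have q: "q \<ge> 2" using assms(1) by simp
  have card_V: "int (card ?V) = int q ^ n - 1"
    using q assms(1) by (simp add: card_Diff_singleton card_carrier_vec of_nat_diff)
  have split: "{..<n} = insert 0 {1..n - 1}" using assms(2) by auto
  have "int (card ?X) * (int q ^ n - 1) = int (card (?X \<times> ?V))"
    by (simp only: card_cartesian_product of_nat_mult card_V)
  also have "\<dots> = int (card {bs :: 'a vec list. length bs = n \<and> indep_list n bs})"
    using bij_betw_same_card[OF bij_betw_cyclic_pairs_bases[OF assms(2-5)]] by simp
  also have "\<dots> = (\<Prod>i<n. int q ^ n - int q ^ i)"
    using card_indep_lists[where 'a = 'a] assms(1) by simp
  also have "\<dots> = (\<Prod>i = 1..n - 1. int q ^ n - int q ^ i) * (int q ^ n - 1)"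
    unfolding split by simp
  finally have "int (card ?X) * (int q ^ n - 1) =
      (\<Prod>i = 1..n - 1. int q ^ n - int q ^ i) * (int q ^ n - 1)" .
  moreover have "int q ^ n > 1" using q assms(2) by (intro one_less_power) auto
  ultimately show ?thesis by simp
qed

end
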